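(* Let $R$ be a polynomial ring over a field and let $I$ be a square-free monomial ideal of $R$ with minimal monomial generating set $f_1,\ldots,f_n$, where $n\leq 5$. Suppose that there do not exist an integer $s\geq 2$ and sequences $\alpha=(a_1,\ldots,a_s)$ and $\beta=(b_1,\ldots,b_1,b_2)$ of length $s$ (up to reordering, with $b_1$ occurring $s-1$ times followed by $b_2$) with entries in $\{1,\ldots,n\}$ and $a_i\neq b_j$ for all $i,j$, such that both of the following hold: (1) for every $i\in\{1,\ldots,s\}$ there is a variable $x_i\in R$ such that $x_i\mid f_{a_j}$ for all $j\neq i$, $x_i\mid f_{b_1}$, $x_i\nmid f_{a_i}$, and $x_i\nmid f_{b_2}$; (2) for every $i\in\{1,\ldots,s\}$ there is a variable $z_i\in R$ such that $z_i\mid\gcd(f_{a_i},f_{b_2})$, $z_i\nmid f_{a_j}$ for all $j\neq i$, and $z_i\nmid f_{b_1}$. Then $I$ is an ideal of linear type.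
   Context: For an ideal $I$ of $R$ with minimal monomial generating set $f_1,\ldots,f_n$, the Rees algebra is $\mathcal{R}(I)=R[It]\subset R[t]$. Let $S=R[T_1,\ldots,T_n]$, let $\phi:S\to\mathcal{R}(I)$ be the $R$-algebra epimorphism with $\phi(T_i)=f_it$, and let $J=\ker\phi$, which is graded by degree in the $T_i$. The ideal $I$ is of linear type if $J$ is generated by its elements of degree $1$ in the $T_i$ (equivalently, the natural map ${\rm Sym}(I)\to\mathcal{R}(I)$ is an isomorphism). *)

theory Defs
  imports
    "HOL-Library.Poly_Mapping"
    "HOL-Library.Multiset"
    "HOL-Computational_Algebra.Polynomial"
    "HOL-Algebra.Generated_Rings"
    "HOL-Algebra.Algebraic_Closure_Type"
begin

text \<open>
  \<open>('x, 'a) mpoly_ring\<close> is the polynomial ring over \<open>'a\<close> in the variables \<open>'x\<close>: a polynomial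
  is a finitely supported map from exponent vectors to coefficients, multiplied by convolution.
\<close>

type_synonym ('x, 'a) mpoly_ring = "('x \<Rightarrow>\<^sub>0 nat) \<Rightarrow>\<^sub>0 'a"

definition Var :: "'x \<Rightarrow> ('x, 'k::field) mpoly_ring" where
  "Var x = Poly_Mapping.single (Poly_Mapping.single x 1) 1"

definition is_monomial :: "('x, 'k::field) mpoly_ring \<Rightarrow> bool" where
  "is_monomial p \<longleftrightarrow> (\<exists>e. p = Poly_Mapping.single e 1)"

definition is_squarefree_monomial :: "('x, 'k::field) mpoly_ring \<Rightarrow> bool" where
  "is_squarefree_monomial p \<longleftrightarrow>
     (\<exists>e. p = Poly_Mapping.single e 1 \<and> (\<forall>x. Poly_Mapping.lookup e x \<le> 1))"

definition ideal_of :: "'a::comm_ring_1 set \<Rightarrow> 'a set" where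
  "ideal_of G = Idl\<^bsub>ring_of_type_algebra\<^esub> G"

definition is_squarefree_monomial_ideal :: "('x, 'k::field) mpoly_ring set \<Rightarrow> bool" where
  "is_squarefree_monomial_ideal I \<longleftrightarrow>
     (\<exists>M. (\<forall>m\<in>M. is_squarefree_monomial m) \<and> I = ideal_of M)"

definition is_minimal_monomial_generating_set ::
    "('x, 'k::field) mpoly_ring set \<Rightarrow> nat \<Rightarrow> (nat \<Rightarrow> ('x, 'k) mpoly_ring) \<Rightarrow> bool" where
  "is_minimal_monomial_generating_set I n f \<longleftrightarrow>
     (\<forall>i\<in>{1..n}. is_monomial (f i)) \<and> inj_on f {1..n} \<and>
     I = ideal_of (f ` {1..n}) \<and>
     (\<forall>G. G \<subset> f ` {1..n} \<longrightarrow> ideal_of G \<noteq> I)"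

text \<open>The Rees algebra $R[It]$: the subring of $R[t]$ generated by $R$ and by all $at$ with $a \in I$.\<close>

definition rees_algebra :: "'a::comm_ring_1 set \<Rightarrow> 'a poly ring" where
  "rees_algebra I = ring_of_type_algebra
     \<lparr>carrier := generate_ring ring_of_type_algebra
        ({[:r:] | r. True} \<union> {Polynomial.monom a 1 | a. a \<in> I})\<rparr>"

text \<open>
  The ring $S = R[T_1,\ldots,T_n]$, cut out of the polynomial ring in the variables $T_i$,
  $i \in \mathbb{N}$, by allowing only exponent vectors supported in $\{1,\ldots,n\}$.
\<close>

definition T_ring :: "nat \<Rightarrow> (nat, 'a::comm_ring_1) mpoly_ring ring" where
  "T_ring n = ring_of_type_algebra
     \<lparr>carrier := {P. \<forall>m\<in>Poly_Mapping.keys P. Poly_Mapping.keys m \<subseteq> {1..n}}\<rparr>"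

definition T_homogeneous :: "nat \<Rightarrow> (nat, 'a::comm_ring_1) mpoly_ring \<Rightarrow> bool" where
  "T_homogeneous d P \<longleftrightarrow>
     (\<forall>m\<in>Poly_Mapping.keys P. (\<Sum>i\<in>Poly_Mapping.keys m. Poly_Mapping.lookup m i) = d)"

text \<open>The $R$-algebra homomorphism $\phi$ with $\phi(T_i) = f_i t$.\<close>

definition rees_map ::
    "(nat \<Rightarrow> 'a::comm_ring_1) \<Rightarrow> (nat, 'a) mpoly_ring \<Rightarrow> 'a poly" where
  "rees_map f P = (\<Sum>m\<in>Poly_Mapping.keys P. [:Poly_Mapping.lookup P m:] *
     (\<Prod>i\<in>Poly_Mapping.keys m. Polynomial.monom (f i) 1 ^ Poly_Mapping.lookup m i))"

definition rees_ideal ::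
    "'a::comm_ring_1 set \<Rightarrow> nat \<Rightarrow> (nat \<Rightarrow> 'a) \<Rightarrow> (nat, 'a) mpoly_ring set" where
  "rees_ideal I n f = a_kernel (T_ring n) (rees_algebra I) (rees_map f)"

text \<open>
  Linear type is expressed through the presentation of the Rees algebra given by the
  generators \<open>f 1, \<dots>, f n\<close> of \<open>I\<close>.
\<close>

definition is_of_linear_type :: "'a::comm_ring_1 set \<Rightarrow> nat \<Rightarrow> (nat \<Rightarrow> 'a) \<Rightarrow> bool" where
  "is_of_linear_type I n f \<longleftrightarrow>
     rees_ideal I n f = Idl\<^bsub>T_ring n\<^esub> {P \<in> rees_ideal I n f. T_homogeneous 1 P}"

end

theory Submission
  imports Defs
begin

text \<open>
  The kernel \<open>J\<close> is spanned by differences of monomials \<open>x^e T^m\<close> with the same \<open>T\<close>-degree and the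
  same image under \<open>\<phi>\<close>. Two such monomials are congruent modulo the ideal generated by the linear
  part of \<open>J\<close> as soon as they share some \<open>T_i\<close>, by induction on the degree. If \<open>T^m\<close> and \<open>T^m'\<close>
  have disjoint supports, it suffices to replace one generator in one of them by a generator of the
  other without leaving the fibre of \<open>\<phi>\<close>: the result shares a factor with both. One of the two
  supports has at most two elements because \<open>n \<le> 5\<close>; if every exchange is blocked, the blocking
  variables produce a forbidden pattern with \<open>s = 2\<close>. Every forbidden pattern restricts to one
  with \<open>s = 2\<close>, so longer ones play no role.
\<close>

section \<open>Polynomial mappings\<close>

abbreviation keys :: "('b \<Rightarrow>\<^sub>0 'c::zero) \<Rightarrow> 'b set" where
  "keys \<equiv> Poly_Mapping.keys"

abbreviation lookup :: "('b \<Rightarrow>\<^sub>0 'c::zero) \<Rightarrow> 'b \<Rightarrow> 'c" where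
  "lookup \<equiv> Poly_Mapping.lookup"

lemma sum_single_lookup: "(\<Sum>m\<in>keys p. Poly_Mapping.single m (lookup p m)) = p"
proof (rule poly_mapping_eqI)
  fix k
  have "lookup (\<Sum>m\<in>keys p. Poly_Mapping.single m (lookup p m)) k
      = (\<Sum>m\<in>keys p. if m = k then lookup p k else 0)"
    unfolding lookup_sum by (rule sum.cong) (auto simp: lookup_single when_def)
  also have "\<dots> = lookup p k"
    by (simp add: in_keys_iff)
  finally show "lookup (\<Sum>m\<in>keys p. Poly_Mapping.single m (lookup p m)) k = lookup p k" .
qed

lemma keys_add_nat: "keys (p + q :: 'b \<Rightarrow>\<^sub>0 nat) = keys p \<union> keys q"
  by (auto simp: in_keys_iff lookup_add)

lemma minus_single_add:
  fixes m :: "'b \<Rightarrow>\<^sub>0 nat"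
  assumes "i \<in> keys m"
  shows "m - Poly_Mapping.single i 1 + Poly_Mapping.single i 1 = m"
  using assms
  by (intro poly_mapping_eqI) (auto simp: lookup_add lookup_minus lookup_single when_def in_keys_iff)

lemma minus_add_pointwise_le:
  fixes p q :: "'b \<Rightarrow>\<^sub>0 nat"
  assumes "\<And>x. lookup p x \<le> lookup q x"
  shows "q - p + p = q"
  using assms by (intro poly_mapping_eqI) (simp add: lookup_add lookup_minus)

lemma keys_single_mult_subset:
  fixes q :: "('x, 'k::field) mpoly_ring"
  assumes "k \<in> keys (Poly_Mapping.single e 1 * q)"
  obtains d where "k = e + d"
  using assms keys_mult[of "Poly_Mapping.single e 1" q] by auto

lemma Var_dvd_single_iff:
  "(Var x :: ('x, 'k::field) mpoly_ring) dvd Poly_Mapping.single e 1 \<longleftrightarrow> lookup e x \<noteq> 0"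
proof
  assume "(Var x :: ('x, 'k::field) mpoly_ring) dvd Poly_Mapping.single e 1"
  then obtain q :: "('x, 'k) mpoly_ring"
    where q: "Poly_Mapping.single e 1 = Poly_Mapping.single (Poly_Mapping.single x 1) 1 * q"
    unfolding Var_def dvd_def by blast
  have "e \<in> keys (Poly_Mapping.single e 1 :: ('x, 'k) mpoly_ring)" by simp
  then obtain d where "e = Poly_Mapping.single x 1 + d"
    unfolding q by (rule keys_single_mult_subset)
  then show "lookup e x \<noteq> 0" by (simp add: lookup_add)
next
  assume "lookup e x \<noteq> 0"
  then have "e - Poly_Mapping.single x 1 + Poly_Mapping.single x 1 = e"
    by (intro minus_single_add) (simp add: in_keys_iff)
  then have "(Poly_Mapping.single e 1 :: ('x, 'k) mpoly_ring)
      = Var x * Poly_Mapping.single (e - Poly_Mapping.single x 1) 1"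
    by (simp add: Var_def mult_single add.commute)
  then show "(Var x :: ('x, 'k) mpoly_ring) dvd Poly_Mapping.single e 1" by simp
qed

section \<open>Monomial ideals\<close>

lemma ring_of_type_algebra_simps [simp]:
  "carrier ring_of_type_algebra = UNIV"
  "monoid.mult ring_of_type_algebra = (*)"
  "one ring_of_type_algebra = 1"
  "ring.zero ring_of_type_algebra = 0"
  "add ring_of_type_algebra = (+)"
  by (auto simp: ring_of_type_algebra_def fun_eq_iff)

lemma ideal_of_is_ideal: "ideal (ideal_of G) ring_of_type_algebra"
  unfolding ideal_of_def by (rule ring.genideal_ideal) auto

lemma ideal_of_superset: "G \<subseteq> ideal_of G"
  unfolding ideal_of_def by (rule ring.genideal_self) auto

lemma ideal_of_least: "ideal L ring_of_type_algebra \<Longrightarrow> G \<subseteq> L \<Longrightarrow> ideal_of G \<subseteq> L"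
  unfolding ideal_of_def by (rule ring.genideal_minimal) auto

lemma ideal_of_dvd:
  assumes "g \<in> ideal_of G" "g dvd h"
  shows "h \<in> ideal_of G"
proof -
  interpret ideal "ideal_of G" ring_of_type_algebra by (rule ideal_of_is_ideal)
  show ?thesis using assms I_r_closed[of g] by (auto simp: dvd_def)
qed

text \<open>It contains every monomial with exponent in \<open>B\<close>, so by minimality it
  contains the whole ideal that these monomials generate. This turns ideal membership of a monomial
  into divisibility by a generator.\<close>

lemma monomial_multiples_ideal:
  fixes B :: "('x \<Rightarrow>\<^sub>0 nat) set"
  shows "ideal {p :: ('x, 'k::field) mpoly_ring. \<forall>k\<in>keys p. \<exists>e\<in>B. \<exists>d. k = e + d}
    ring_of_type_algebra" (is "ideal ?L ?R")
proof -
  interpret ring ?R by (rule ring_from_type_algebra)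
  have l: "r * p \<in> ?L" if "p \<in> ?L" for r p
  proof -
    have "\<exists>e\<in>B. \<exists>d. k = e + d" if "k \<in> keys (r * p)" for k
    proof -
      from \<open>k \<in> keys (r * p)\<close> keys_mult[of r p] obtain a b
        where "k = a + b" "b \<in> keys p" by auto
      with \<open>p \<in> ?L\<close> obtain e d where "e \<in> B" "b = e + d" by auto
      then have "k = e + (a + d)" using \<open>k = a + b\<close> by (simp add: ac_simps)
      then show ?thesis using \<open>e \<in> B\<close> by blast
    qed
    then show ?thesis by blast
  qed
  show ?thesis
  proof (rule idealI)
    show "ring ?R" by (rule ring_from_type_algebra)
    show "subgroup ?L (add_monoid ?R)"
    proof (rule add.subgroupI)
      show "?L \<subseteq> carrier ?R" by simp
      show "?L \<noteq> {}" by (auto intro!: exI[of _ 0])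
      fix a assume a: "a \<in> ?L"
      \<comment> \<open>The record's additive inverse is identified with \<open>(-1) * a\<close>, so
        that closure under multiples yields closure under inverses.\<close>
      have "a + \<ominus>\<^bsub>?R\<^esub> a = 0" using r_neg[of a] by simp
      then have "\<ominus>\<^bsub>?R\<^esub> a = (-1) * a" by (simp add: eq_neg_iff_add_eq_0 add.commute)
      then show "\<ominus>\<^bsub>?R\<^esub> a \<in> ?L" using l[OF a, of "-1"] by simp
    next
      fix a b assume "a \<in> ?L" "b \<in> ?L"
      then show "a \<oplus>\<^bsub>?R\<^esub> b \<in> ?L" using keys_add[of a b] by auto
    qed
    show "x \<otimes>\<^bsub>?R\<^esub> a \<in> ?L" "a \<otimes>\<^bsub>?R\<^esub> x \<in> ?L" if "a \<in> ?L" for a x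
      using l[OF that, of x] by (auto simp: mult.commute)
  qed
qed

lemma monomial_in_ideal_of:
  fixes B :: "('x \<Rightarrow>\<^sub>0 nat) set" and mon :: "('x \<Rightarrow>\<^sub>0 nat) \<Rightarrow> ('x, 'k::field) mpoly_ring"
  assumes mon: "\<And>e. mon e = Poly_Mapping.single e 1"
    and k: "mon k \<in> ideal_of (mon ` B)"
  obtains e d where "e \<in> B" "k = e + d"
proof -
  have "mon ` B \<subseteq> {p. \<forall>k\<in>keys p. \<exists>e\<in>B. \<exists>d. k = e + d}"
  proof (rule image_subsetI)
    fix e assume "e \<in> B"
    moreover have "e = e + 0" by simp
    ultimately have "\<exists>e'\<in>B. \<exists>d. e = e' + d" by blast
    then show "mon e \<in> {p. \<forall>k\<in>keys p. \<exists>e\<in>B. \<exists>d. k = e + d}" by (simp add: mon)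
  qed
  then have "mon k \<in> {p. \<forall>k\<in>keys p. \<exists>e\<in>B. \<exists>d. k = e + d}"
    using ideal_of_least[OF monomial_multiples_ideal] k by blast
  then show ?thesis using that by (auto simp: mon)
qed

text \<open>The hypotheses provide some square-free generating set \<open>M\<close>, which need not
  be the family \<open>f\<close>. Each \<open>f i\<close> is a multiple of a monomial of
  \<open>M\<close>, which in turn is a multiple of some \<open>f j\<close>; minimality forces
  \<open>j = i\<close>, so \<open>f i\<close> inherits square-freeness.\<close>

lemma minimal_generators_squarefree:
  fixes f :: "nat \<Rightarrow> ('x, 'k::field) mpoly_ring"
  assumes "is_squarefree_monomial_ideal I"
    and min: "is_minimal_monomial_generating_set I n f"
  obtains E where "\<And>i. i \<in> {1..n} \<Longrightarrow> f i = Poly_Mapping.single (E i) 1"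
    and "\<And>i x. i \<in> {1..n} \<Longrightarrow> lookup (E i) x \<le> 1"
proof -
  define mon :: "('x \<Rightarrow>\<^sub>0 nat) \<Rightarrow> ('x, 'k) mpoly_ring" where "mon e = Poly_Mapping.single e 1" for e
  from min have "\<forall>i\<in>{1..n}. \<exists>e. f i = mon e"
    unfolding is_minimal_monomial_generating_set_def is_monomial_def mon_def by blast
  from bchoice[OF this] obtain E where "\<forall>i\<in>{1..n}. f i = mon (E i)" by blast
  then have E: "f i = mon (E i)" if "i \<in> {1..n}" for i using that by blast
  note min' = min[unfolded is_minimal_monomial_generating_set_def]
  have inj: "inj_on f {1..n}" using min' by (elim conjE)
  have If: "I = ideal_of (f ` {1..n})" using min' by (elim conjE)
  have nosub: "ideal_of G \<noteq> I" if "G \<subset> f ` {1..n}" for G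
    using conjunct2[OF conjunct2[OF conjunct2[OF min']], rule_format, OF that] .
  have fim: "f ` {1..n} = mon ` E ` {1..n}" 
    unfolding image_image by (rule image_cong[OF refl]) (rule E)
  from assms(1) obtain M where M: "\<forall>m\<in>M. is_squarefree_monomial m" and IM: "I = ideal_of M"
    unfolding is_squarefree_monomial_ideal_def by blast
  define B where "B = {e. mon e \<in> M}"
  have MB: "M = mon ` B"
  proof
    show "M \<subseteq> mon ` B"
    proof
      fix g assume "g \<in> M"
      moreover obtain e where "g = mon e"
        using M \<open>g \<in> M\<close> unfolding is_squarefree_monomial_def mon_def by blast
      ultimately show "g \<in> mon ` B" unfolding B_def by blast
    qed
    show "mon ` B \<subseteq> M" unfolding B_def by blast
  qed
  have Bsf: "lookup e x \<le> 1" if "e \<in> B" for e x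
  proof -
    have "is_squarefree_monomial (mon e)" using M that unfolding B_def by blast
    then obtain e' where e': "mon e = Poly_Mapping.single e' 1" "lookup e' x \<le> 1"
      unfolding is_squarefree_monomial_def by blast
    then have "keys (mon e) = {e'}" by simp
    then have "e = e'" unfolding mon_def by simp
    with e'(2) show ?thesis by simp
  qed
  have "lookup (E i) x \<le> 1" if i: "i \<in> {1..n}" for i x
  proof -
    have "f i \<in> I" unfolding If using ideal_of_superset i by blast
    then have "mon (E i) \<in> ideal_of (mon ` B)" unfolding E[OF i] IM MB .
    then obtain e d where e: "e \<in> B" "E i = e + d" by (rule monomial_in_ideal_of[OF mon_def])
    have "mon e \<in> I" unfolding IM MB using ideal_of_superset e(1) by blast
    then have "mon e \<in> ideal_of (mon ` E ` {1..n})" unfolding If fim .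
    then obtain e' d' where "e' \<in> E ` {1..n}" "e = e' + d'"
      by (rule monomial_in_ideal_of[OF mon_def])
    then obtain j where j: "j \<in> {1..n}" "e = E j + d'" by blast
    \<comment> \<open>Otherwise \<open>f j\<close> divides \<open>f i\<close>, and the generators
      other than \<open>f i\<close> already generate \<open>I\<close>, against minimality.\<close>
    have "j = i"
    proof (rule ccontr)
      assume "j \<noteq> i"
      define G where "G = f ` ({1..n} - {i})"
      have "f i \<notin> G" using inj i unfolding G_def by (auto dest: inj_onD)
      then have sub: "G \<subset> f ` {1..n}" using i unfolding G_def by blast
      have "f j \<in> ideal_of G"
        using ideal_of_superset[of G] j(1) \<open>j \<noteq> i\<close> unfolding G_def by blast
      moreover have "f i = f j * mon (d' + d)"
        unfolding E[OF i] E[OF j(1)] e(2) j(2) by (simp add: mon_def mult_single add.assoc)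
      then have "f j dvd f i" by simp
      ultimately have "f i \<in> ideal_of G" by (rule ideal_of_dvd)
      then have "f ` {1..n} \<subseteq> ideal_of G"
        using ideal_of_superset[of G] unfolding G_def by blast
      then have "I \<subseteq> ideal_of G" unfolding If by (rule ideal_of_least[OF ideal_of_is_ideal])
      moreover have "ideal_of G \<subseteq> I" unfolding If
        using sub ideal_of_superset[of "f ` {1..n}"]
        by (intro ideal_of_least[OF ideal_of_is_ideal]) blast
      ultimately show False using nosub[OF sub] by blast
    qed
    \<comment> \<open>With \<open>j = i\<close>, both \<open>E i = e + d\<close> and
      \<open>e = E i + d'\<close> hold; the second bounds \<open>E i\<close> by the square-free
      exponent \<open>e\<close>.\<close>
    then have "lookup (E i) x \<le> lookup e x" using j(2) by (simp add: lookup_add)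
    then show ?thesis using Bsf[OF e(1), of x] by linarith
  qed
  show ?thesis
  proof (rule that)
    show "f i = Poly_Mapping.single (E i) 1" if "i \<in> {1..n}" for i using E[OF that] unfolding mon_def .
  qed fact
qed

section \<open>The presentation of the Rees algebra\<close>

lemma T_ring_simps [simp]:
  "monoid.mult (T_ring n) = (*)"
  "one (T_ring n) = 1"
  "ring.zero (T_ring n) = 0"
  "add (T_ring n) = (+)"
  by (auto simp: T_ring_def)

lemma mem_T_ring: "P \<in> carrier (T_ring n) \<longleftrightarrow> (\<forall>m\<in>keys P. keys m \<subseteq> {1..n})"
  by (simp add: T_ring_def)

lemma single_mem_T_ring: "keys m \<subseteq> {1..n} \<Longrightarrow> Poly_Mapping.single m r \<in> carrier (T_ring n)"
  by (simp add: mem_T_ring)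

lemma zero_mem_T_ring: "0 \<in> carrier (T_ring n)"
  by (simp add: mem_T_ring)

lemma one_mem_T_ring: "1 \<in> carrier (T_ring n)"
  by (simp add: mem_T_ring)

lemma T_ring_add: "P \<in> carrier (T_ring n) \<Longrightarrow> Q \<in> carrier (T_ring n) \<Longrightarrow> P + Q \<in> carrier (T_ring n)"
  using keys_add[of P Q] by (auto simp: mem_T_ring)

lemma T_ring_mult:
  assumes "P \<in> carrier (T_ring n)" "Q \<in> carrier (T_ring n)"
  shows "P * Q \<in> carrier (T_ring n)"
  unfolding mem_T_ring
proof
  fix m assume "m \<in> keys (P * Q)"
  then obtain a b where "m = a + b" "a \<in> keys P" "b \<in> keys Q" using keys_mult[of P Q] by auto
  then show "keys m \<subseteq> {1..n}" using assms by (auto simp: mem_T_ring keys_add_nat)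
qed

lemma T_ring_uminus: "P \<in> carrier (T_ring n) \<Longrightarrow> - P \<in> carrier (T_ring n)"
  by (simp add: mem_T_ring in_keys_iff)

lemma T_ring_ring: "ring (T_ring n :: (nat, 'a::comm_ring_1) mpoly_ring ring)"
proof (rule ringI)
  show "abelian_group (T_ring n :: (nat, 'a) mpoly_ring ring)"
  proof (rule abelian_groupI)
    fix x :: "(nat, 'a) mpoly_ring" assume "x \<in> carrier (T_ring n)"
    then show "\<exists>y\<in>carrier (T_ring n). y \<oplus>\<^bsub>T_ring n\<^esub> x = \<zero>\<^bsub>T_ring n\<^esub>"
      by (intro bexI[of _ "- x"]) (auto intro: T_ring_uminus)
  qed (auto intro: T_ring_add zero_mem_T_ring simp: algebra_simps)
  show "monoid (T_ring n :: (nat, 'a) mpoly_ring ring)"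
    by (rule monoidI) (auto intro: T_ring_mult one_mem_T_ring simp: algebra_simps)
qed (auto simp: algebra_simps)

text \<open>The value \<phi>(T^m) on a monomial in the T_i.\<close>

definition T_image :: "(nat \<Rightarrow> 'a::comm_ring_1) \<Rightarrow> (nat \<Rightarrow>\<^sub>0 nat) \<Rightarrow> 'a poly" where
  "T_image f m = (\<Prod>i\<in>keys m. Polynomial.monom (f i) 1 ^ lookup m i)"

text \<open>Outside the support all factors are \<open>1\<close>, so images of different monomials
  can be compared over one common index set. The same device serves for \<open>rees_map\<close>
  below.\<close>

lemma T_image_superset:
  assumes "finite A" "keys m \<subseteq> A"
  shows "T_image f m = (\<Prod>i\<in>A. Polynomial.monom (f i) 1 ^ lookup m i)"
  unfolding T_image_def using assms
  by (intro prod.mono_neutral_left) (auto simp: in_keys_iff)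

lemma T_image_add: "T_image f (m + m') = T_image f m * T_image f m'"
proof -
  let ?A = "keys m \<union> keys m'"
  have "T_image f (m + m') = (\<Prod>i\<in>?A. Polynomial.monom (f i) 1 ^ lookup (m + m') i)"
    by (rule T_image_superset) (auto simp: keys_add_nat)
  also have "\<dots> = T_image f m * T_image f m'"
    by (simp add: T_image_superset[of ?A] lookup_add power_add prod.distrib)
  finally show ?thesis .
qed

lemma rees_map_superset:
  assumes "finite A" "keys P \<subseteq> A"
  shows "rees_map f P = (\<Sum>m\<in>A. [:lookup P m:] * T_image f m)"
  unfolding rees_map_def T_image_def[symmetric] using assms
  by (intro sum.mono_neutral_left) (auto simp: in_keys_iff)

lemma rees_map_add: "rees_map f (P + Q) = rees_map f P + rees_map f Q"
proof -
  let ?A = "keys P \<union> keys Q"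
  have "rees_map f (P + Q) = (\<Sum>m\<in>?A. [:lookup (P + Q) m:] * T_image f m)"
    using keys_add[of P Q] by (intro rees_map_superset) auto
  also have "\<dots> = (\<Sum>m\<in>?A. [:lookup P m:] * T_image f m + [:lookup Q m:] * T_image f m)"
    by (intro sum.cong refl) (metis add_pCons add_0 lookup_add distrib_right)
  also have "\<dots> = rees_map f P + rees_map f Q"
    by (simp only: sum.distrib) (simp only: rees_map_superset[of ?A] finite_UnI finite_keys Un_upper1 Un_upper2)
  finally show ?thesis .
qed

lemma rees_map_zero [simp]: "rees_map f 0 = 0"
  by (simp add: rees_map_def)

lemma rees_map_single: "rees_map f (Poly_Mapping.single m r) = [:r:] * T_image f m"
  by (subst rees_map_superset[of "{m}"]) auto

lemma rees_map_sum: "rees_map f (\<Sum>a\<in>A. P a) = (\<Sum>a\<in>A. rees_map f (P a))"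
  by (induction A rule: infinite_finite_induct) (auto simp: rees_map_add)

lemma rees_map_uminus: "rees_map f (- P) = - rees_map f P"
  using rees_map_add[of f P "- P"] by (simp add: eq_neg_iff_add_eq_0 add.commute)

text \<open>Both factors are expanded into monomials; there multiplicativity is the exponent law
  \<open>T_image_add\<close>, and distributivity does the rest.\<close>

lemma rees_map_mult: "rees_map f (P * Q) = rees_map f P * rees_map f Q"
proof -
  have "P * Q = (\<Sum>m\<in>keys P. \<Sum>m'\<in>keys Q.
      Poly_Mapping.single m (lookup P m) * Poly_Mapping.single m' (lookup Q m'))"
    by (simp only: sum_product[symmetric] sum_single_lookup)
  also have "rees_map f \<dots> = (\<Sum>m\<in>keys P. \<Sum>m'\<in>keys Q.
      ([:lookup P m:] * T_image f m) * ([:lookup Q m':] * T_image f m'))"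
    unfolding rees_map_sum
    by (intro sum.cong refl) (simp add: mult_single rees_map_single T_image_add ac_simps)
  also have "\<dots> = rees_map f P * rees_map f Q"
    unfolding sum_product[symmetric] rees_map_def T_image_def by simp
  finally show ?thesis .
qed

text \<open>The zero of the Rees algebra is that of the polynomial ring R[t] containing it.\<close>

lemma mem_rees_ideal: "P \<in> rees_ideal I n f \<longleftrightarrow> P \<in> carrier (T_ring n) \<and> rees_map f P = 0"
  by (simp add: rees_ideal_def a_kernel_def' rees_algebra_def)

lemma rees_ideal_is_ideal: "ideal (rees_ideal I n f) (T_ring n)"
proof -
  interpret ring "T_ring n :: (nat, 'a) mpoly_ring ring" by (rule T_ring_ring)
  show ?thesis
  proof (rule idealI[OF T_ring_ring])
    show "subgroup (rees_ideal I n f) (add_monoid (T_ring n))"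
    proof (rule add.subgroupI)
      show "rees_ideal I n f \<subseteq> carrier (T_ring n)" by (auto simp: mem_rees_ideal)
      have "0 \<in> rees_ideal I n f" by (simp add: mem_rees_ideal zero_mem_T_ring)
      then show "rees_ideal I n f \<noteq> {}" by blast
      fix P assume P: "P \<in> rees_ideal I n f"
      then have "P + \<ominus>\<^bsub>T_ring n\<^esub> P = 0" using r_neg[of P] by (simp add: mem_rees_ideal)
      then have "\<ominus>\<^bsub>T_ring n\<^esub> P = - P" by (simp add: eq_neg_iff_add_eq_0 add.commute)
      then show "\<ominus>\<^bsub>T_ring n\<^esub> P \<in> rees_ideal I n f"
        using P by (simp add: mem_rees_ideal T_ring_uminus rees_map_uminus)
    qed (auto simp: mem_rees_ideal rees_map_add T_ring_add)
  qed (auto simp: mem_rees_ideal rees_map_mult T_ring_mult)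
qed

text \<open>Phrasing closure with the operations of the type instead of those of the record lets the
  congruences below be computed by ordinary arithmetic.\<close>

lemma ideal_T_ring_closed:
  assumes "ideal K (T_ring n)"
  shows "0 \<in> K"
    and "P \<in> K \<Longrightarrow> Q \<in> K \<Longrightarrow> P + Q \<in> K"
    and "P \<in> K \<Longrightarrow> Q \<in> carrier (T_ring n) \<Longrightarrow> Q * P \<in> K"
    and "(\<And>a. a \<in> A \<Longrightarrow> R a \<in> K) \<Longrightarrow> sum R A \<in> K"
proof -
  interpret ideal K "T_ring n" by fact
  show 0: "0 \<in> K" using additive_subgroup.zero_closed[OF is_additive_subgroup] by simp
  show add: "P \<in> K \<Longrightarrow> Q \<in> K \<Longrightarrow> P + Q \<in> K" for P Q using additive_subgroup.a_closed[OF is_additive_subgroup, of P Q] by simp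
  show "P \<in> K \<Longrightarrow> Q \<in> carrier (T_ring n) \<Longrightarrow> Q * P \<in> K" using I_l_closed[of P Q] by simp
  show "(\<And>a. a \<in> A \<Longrightarrow> R a \<in> K) \<Longrightarrow> sum R A \<in> K"
    by (induction A rule: infinite_finite_induct) (auto intro: 0 add)
qed

section \<open>Degrees and weights of monomials in the variables T\<close>

definition T_degree :: "(nat \<Rightarrow>\<^sub>0 nat) \<Rightarrow> nat" where
  "T_degree m = (\<Sum>i\<in>keys m. lookup m i)"

text \<open>For \<open>f i\<close> = x^(E i) this is the exponent vector of the product of the
  \<open>f i\<close> with multiplicities \<open>m\<close>. Together with \<open>T_degree m\<close>
  it determines \<phi>(T^m), see \<open>T_image_monomials\<close>.\<close>

definition T_weight :: "(nat \<Rightarrow> ('x \<Rightarrow>\<^sub>0 nat)) \<Rightarrow> (nat \<Rightarrow>\<^sub>0 nat) \<Rightarrow> ('x \<Rightarrow>\<^sub>0 nat)" where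
  "T_weight E m = (\<Sum>i\<in>keys m. Poly_Mapping.map ((*) (lookup m i)) (E i))"

lemma lookup_map_mult: "lookup (Poly_Mapping.map ((*) k) p) x = k * (lookup p x :: nat)"
  by (simp add: Poly_Mapping.map.rep_eq when_def)

lemma lookup_T_weight: "lookup (T_weight E m) x = (\<Sum>i\<in>keys m. lookup m i * lookup (E i) x)"
  by (simp add: T_weight_def lookup_sum lookup_map_mult)

lemma T_degree_add: "T_degree (m + m') = T_degree m + T_degree m'"
proof -
  have *: "T_degree p = (\<Sum>i\<in>keys m \<union> keys m'. lookup p i)" if "keys p \<subseteq> keys m \<union> keys m'" for p
    unfolding T_degree_def using that by (intro sum.mono_neutral_left) (auto simp: in_keys_iff)
  show ?thesis by (simp add: * keys_add_nat lookup_add sum.distrib)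
qed

lemma T_weight_add: "T_weight E (m + m') = T_weight E m + T_weight E m'"
proof (rule poly_mapping_eqI)
  fix x
  have *: "lookup (T_weight E p) x = (\<Sum>i\<in>keys m \<union> keys m'. lookup p i * lookup (E i) x)"
    if "keys p \<subseteq> keys m \<union> keys m'" for p
    unfolding lookup_T_weight using that by (intro sum.mono_neutral_left) (auto simp: in_keys_iff)
  show "lookup (T_weight E (m + m')) x = lookup (T_weight E m + T_weight E m') x"
    by (simp add: * keys_add_nat lookup_add sum.distrib distrib_right)
qed

lemma T_degree_single [simp]: "T_degree (Poly_Mapping.single i (Suc 0)) = 1"
  by (simp add: T_degree_def)

lemma T_weight_single [simp]: "T_weight E (Poly_Mapping.single i (Suc 0)) = E i"
  by (rule poly_mapping_eqI) (simp add: lookup_T_weight)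

lemma T_degree_eq_0_iff: "T_degree m = 0 \<longleftrightarrow> m = 0"
  by (auto simp: T_degree_def poly_mapping_eq_iff fun_eq_iff in_keys_iff)

lemma T_degree_minus_single:
  "i \<in> keys m \<Longrightarrow> Suc (T_degree (m - Poly_Mapping.single i 1)) = T_degree m"
  using T_degree_add[of "m - Poly_Mapping.single i 1" "Poly_Mapping.single i 1"]
  by (simp add: minus_single_add[simplified])

lemma T_weight_minus_single:
  "i \<in> keys m \<Longrightarrow> T_weight E (m - Poly_Mapping.single i 1) + E i = T_weight E m"
  using T_weight_add[of E "m - Poly_Mapping.single i 1" "Poly_Mapping.single i 1"]
  using minus_single_add[of i m] by simp

lemma keys_minus_single_subset:
  "keys (m - Poly_Mapping.single i 1 :: 'b \<Rightarrow>\<^sub>0 nat) \<subseteq> keys m"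
  by (auto simp: in_keys_iff lookup_minus)

lemma monom_single_power:
  "Polynomial.monom (Poly_Mapping.single e (1::'k::field)) (Suc 0) ^ k
    = Polynomial.monom (Poly_Mapping.single (Poly_Mapping.map ((*) k) e :: 'x \<Rightarrow>\<^sub>0 nat) 1) k"
proof (induction k)
  case 0
  have "Poly_Mapping.map ((*) 0) e = 0" by (rule poly_mapping_eqI) (simp add: lookup_map_mult)
  then show ?case by (simp only: single_one power_0 monom_eq_1)
next
  case (Suc k)
  have "e + Poly_Mapping.map ((*) k) e = Poly_Mapping.map ((*) (Suc k)) e"
    by (rule poly_mapping_eqI) (simp add: lookup_map_mult lookup_add)
  then show ?case by (simp only: power_Suc Suc.IH mult_monom mult_single mult_1 add_Suc add_0)
qed

lemma T_image_monomials:
  fixes f :: "nat \<Rightarrow> ('x, 'k::field) mpoly_ring"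
  assumes "\<And>i. i \<in> keys m \<Longrightarrow> f i = Poly_Mapping.single (E i) 1"
  shows "T_image f m = Polynomial.monom (Poly_Mapping.single (T_weight E m) 1) (T_degree m)"
proof -
  \<comment> \<open>Stated for subsets \<open>A\<close> of the support so that induction on finite
    sets applies.\<close>
  have "(\<Prod>i\<in>A. Polynomial.monom (f i) 1 ^ lookup m i)
    = Polynomial.monom (Poly_Mapping.single (\<Sum>i\<in>A. Poly_Mapping.map ((*) (lookup m i)) (E i)) 1)
        (\<Sum>i\<in>A. lookup m i)"
    if "finite A" "A \<subseteq> keys m" for A
    using that
  proof (induction A rule: finite_induct)
    case (insert i A)
    then have "f i = Poly_Mapping.single (E i) 1" using assms by blast
    with insert show ?case by (simp add: monom_single_power mult_monom mult_single)
  qed simp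
  from this[of "keys m"] show ?thesis unfolding T_image_def T_weight_def T_degree_def by simp
qed

section \<open>Exchanging generators between two monomials\<close>

text \<open>For square-free generators the exponent of \<open>x\<close> in the product counts, with
  multiplicity, the factors divisible by \<open>x\<close>. It therefore reaches the degree exactly
  if \<open>x\<close> divides them all; this lemma and the next are the two directions.\<close>

lemma weight_eq_degree:
  assumes "\<And>i. i \<in> keys m \<Longrightarrow> lookup (E i) x = 1"
  shows "lookup (T_weight E m) x = T_degree m"
  using assms by (simp add: lookup_T_weight T_degree_def)

lemma weight_less_degree:
  assumes "\<And>i. i \<in> keys m \<Longrightarrow> lookup (E i) x \<le> 1" "a \<in> keys m" "lookup (E a) x = 0"
  shows "lookup (T_weight E m) x < T_degree m"
  unfolding lookup_T_weight T_degree_def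
proof (rule sum_strict_mono_ex1)
  show "\<forall>i\<in>keys m. lookup m i * lookup (E i) x \<le> lookup m i" using assms(1) by simp
  show "\<exists>i\<in>keys m. lookup m i * lookup (E i) x < lookup m i"
    using assms(2,3) by (intro bexI[of _ a]) (auto simp: in_keys_iff)
qed simp

lemma weight_pos_iff: "0 < lookup (T_weight E m) x \<longleftrightarrow> (\<exists>i\<in>keys m. 0 < lookup (E i) x)"
  by (auto simp: lookup_T_weight in_keys_iff zero_less_iff_neq_zero simp del: neq0_conv)

text \<open>On the three elements, the complement of an irreflexive cotransitive relation is a
  preorder. If two of the three pairs were comparable in it, transitivity through their common
  element would give an element below all three or above all three, which the source and target
  conditions exclude. So each relation holds in both directions on at least two pairs, and two such
  choices out of three overlap.\<close>

lemma cotransitive_pair: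
  fixes D D' :: "'b \<Rightarrow> 'b \<Rightarrow> bool"
  assumes "\<And>i. \<not> D i i" "\<forall>i k. \<forall>l\<in>{u, v, w}. D i k \<longrightarrow> D i l \<or> D l k"
    and "\<And>i. \<not> D' i i" "\<forall>i k. \<forall>l\<in>{u, v, w}. D' i k \<longrightarrow> D' i l \<or> D' l k"
    and "\<forall>i\<in>{u, v, w}. \<exists>k\<in>{u, v, w}. D i k" "\<forall>i\<in>{u, v, w}. \<exists>k\<in>{u, v, w}. D k i"
    and "\<forall>i\<in>{u, v, w}. \<exists>k\<in>{u, v, w}. D' i k" "\<forall>i\<in>{u, v, w}. \<exists>k\<in>{u, v, w}. D' k i"
  shows "\<exists>i\<in>{u, v, w}. \<exists>k\<in>{u, v, w}. D i k \<and> D k i \<and> D' i k \<and> D' k i"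
proof -
  have two: "D u v \<and> D v u \<and> D u w \<and> D w u \<or> D u v \<and> D v u \<and> D v w \<and> D w v \<or>
      D u w \<and> D w u \<and> D v w \<and> D w v"
    if "\<And>i. \<not> D i i" and co: "\<forall>i k. \<forall>l\<in>{u, v, w}. D i k \<longrightarrow> D i l \<or> D l k"
      and "\<forall>i\<in>{u, v, w}. \<exists>k\<in>{u, v, w}. D i k" "\<forall>i\<in>{u, v, w}. \<exists>k\<in>{u, v, w}. D k i"
    for D :: "'b \<Rightarrow> 'b \<Rightarrow> bool"
  proof -
    have "D u v \<or> D u w" "D v u \<or> D v w" "D w u \<or> D w v"
      "D v u \<or> D w u" "D u v \<or> D w v" "D u w \<or> D v w"
      using that(1,3,4) by auto
    moreover have "D u v \<longrightarrow> D u w \<or> D w v" "D u w \<longrightarrow> D u v \<or> D v w"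
      "D v u \<longrightarrow> D v w \<or> D w u" "D v w \<longrightarrow> D v u \<or> D u w"
      "D w u \<longrightarrow> D w v \<or> D v u" "D w v \<longrightarrow> D w u \<or> D u v"
      using co by simp_all
    ultimately show ?thesis by argo
  qed
  show ?thesis using two[OF assms(1,2,5,6)] two[OF assms(3,4,7,8)] by (elim disjE) simp_all
qed

text \<open>
  A variable blocking an exchange divides some but not all generators in either
  support, so for \<open>keys m' = {b, b'}\<close> every \<open>a\<close> in \<open>m\<close> is a source and a target of \<open>D b b'\<close> and of
  \<open>D b' b\<close>.
\<close>

lemma blocked_exchange_pattern:
  fixes E :: "nat \<Rightarrow> ('x \<Rightarrow>\<^sub>0 nat)"
  assumes sf: "\<And>i x. i \<in> keys m \<union> keys m' \<Longrightarrow> lookup (E i) x \<le> 1"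
    and deg: "T_degree m = T_degree m'" "m \<noteq> 0"
    and card: "card (keys m') \<le> 2" "card (keys m) + card (keys m') \<le> 5"
    and blocked: "\<And>a b. a \<in> keys m \<Longrightarrow> b \<in> keys m' \<Longrightarrow>
        \<exists>x. lookup (E a) x < lookup (E b) x \<and> lookup (T_weight E m') x \<le> lookup (T_weight E m) x"
    and blocked': "\<And>a b. a \<in> keys m \<Longrightarrow> b \<in> keys m' \<Longrightarrow>
        \<exists>x. lookup (E b) x < lookup (E a) x \<and> lookup (T_weight E m) x \<le> lookup (T_weight E m') x"
    and D_def: "D = (\<lambda>b b' i k. \<exists>x. lookup (E b) x = 1 \<and> lookup (E b') x = 0 \<and>
        lookup (E i) x = 1 \<and> lookup (E k) x = 0)"
  shows "\<exists>i\<in>keys m. \<exists>k\<in>keys m. \<exists>b\<in>keys m'. \<exists>b'\<in>keys m'.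
    D b b' i k \<and> D b b' k i \<and> D b' b i k \<and> D b' b k i"
proof -
  note sfm = sf[OF UnI1] and sfm' = sf[OF UnI2]
  have "m' \<noteq> 0" using deg T_degree_eq_0_iff by metis
  then have "card (keys m') \<noteq> 0" by (auto simp: poly_mapping_eq_iff fun_eq_iff in_keys_iff)
  \<comment> \<open>\<open>b = b'\<close> is allowed here; a one-element support is excluded below
    by means of \<open>sources\<close>.\<close>
  then have "\<exists>b b'. keys m' = {b, b'}"
    using card(1) by (metis One_nat_def card_1_singletonE card_2_iff insert_absorb2 le_less
        less_2_cases)
  then obtain b1 b2 where bb: "keys m' = {b1, b2}" by blast
  \<comment> \<open>The blocking \<open>x\<close> divides generator \<open>b\<close> but not
    \<open>a\<close>. Its weight in \<open>m\<close>, hence in \<open>m'\<close>, is below the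
    common degree, so \<open>x\<close> cannot divide generator \<open>b'\<close> as well. Its weight
    is positive in \<open>m'\<close>, hence in \<open>m\<close>, so \<open>x\<close> divides some
    generator \<open>k\<close> of \<open>m\<close>.\<close>
  have sources: "\<exists>k\<in>keys m. D b b' k a" if a: "a \<in> keys m" and mb: "keys m' = {b, b'}" for a b b'
  proof -
    obtain x where x: "lookup (E a) x < lookup (E b) x"
        "lookup (T_weight E m') x \<le> lookup (T_weight E m) x"
      using blocked[of a b] a mb by blast
    have b: "lookup (E b) x = 1" "lookup (E a) x = 0" using x(1) sfm'[of b x] a mb by auto
    have "lookup (T_weight E m) x < T_degree m"
      using weight_less_degree[of m E x a] sfm a b(2) by blast
    then have "lookup (E b') x \<noteq> 1"
      using weight_eq_degree[of m' E x] b(1) x(2) deg(1) mb by auto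
    then have b': "lookup (E b') x = 0" using sfm'[of b' x] mb by auto
    have "0 < lookup (T_weight E m') x" unfolding weight_pos_iff using b(1) mb by auto
    then have "0 < lookup (T_weight E m) x" using x(2) by linarith
    then obtain k where "k \<in> keys m" "0 < lookup (E k) x" unfolding weight_pos_iff by blast
    then show ?thesis unfolding D_def using b b' sfm[of k x] by (metis less_one nat_less_le)
  qed
  \<comment> \<open>The mirror argument: \<open>x\<close> divides generator \<open>a\<close> but not
    \<open>b\<close>. Positive weight in \<open>m\<close> carries over to \<open>m'\<close> and
    forces \<open>x\<close> to divide \<open>b'\<close>; weight below the degree carries over from
    \<open>m'\<close> to \<open>m\<close> and yields some \<open>k\<close> that \<open>x\<close>
    does not divide.\<close>
  have targets: "\<exists>k\<in>keys m. D b' b a k" if a: "a \<in> keys m" and mb: "keys m' = {b, b'}" for a b b'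
  proof -
    obtain x where x: "lookup (E b) x < lookup (E a) x"
        "lookup (T_weight E m) x \<le> lookup (T_weight E m') x"
      using blocked'[of a b] a mb by blast
    have b: "lookup (E a) x = 1" "lookup (E b) x = 0" using x(1) sfm[of a x] a mb by auto
    have less: "lookup (T_weight E m') x < T_degree m'"
      using weight_less_degree[of m' E x b] sfm' mb b(2) by blast
    have "0 < lookup (T_weight E m) x" unfolding weight_pos_iff using b(1) a by (intro bexI[of _ a]) auto
    then have "0 < lookup (T_weight E m') x" using x(2) by linarith
    then have "0 < lookup (E b') x" unfolding weight_pos_iff using mb b(2) by auto
    then have b': "lookup (E b') x = 1" using sfm'[of b' x] mb by auto
    obtain k where k: "k \<in> keys m" "lookup (E k) x \<noteq> 1"
      using weight_eq_degree[of m E x] less x(2) deg(1) by fastforce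
    then show ?thesis unfolding D_def using b b' sfm[of k x] by (metis less_one nat_less_le)
  qed
  have "keys m \<noteq> {}" using deg(2) by (auto simp: poly_mapping_eq_iff fun_eq_iff in_keys_iff)
  then obtain a where a: "a \<in> keys m" by blast
  \<comment> \<open>Some variable divides generator \<open>b1\<close> but not \<open>b2\<close>, so
    the two are distinct and at most three of the five places are left for
    \<open>keys m\<close>.\<close>
  have "b1 \<noteq> b2" using sources[OF a bb] unfolding D_def by auto
  then have "card (keys m) \<le> 3" using card(2) bb by simp
  moreover have "card (keys m) \<noteq> 0" using \<open>keys m \<noteq> {}\<close> by simp
  ultimately have "card (keys m) = 1 \<or> card (keys m) = 2 \<or> card (keys m) = 3" by linarith
  \<comment> \<open>Repetitions are allowed, so supports of one or two elements are covered
    too.\<close>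
  then have "\<exists>u v w. keys m = {u, v, w}"
    by (metis card_1_singletonE card_2_iff card_3_iff insert_absorb2)
  then obtain u v w where uvw: "keys m = {u, v, w}" by blast
  have irrefl: "\<not> D b b' i i" for b b' i unfolding D_def by auto
  \<comment> \<open>Square-freeness leaves the exponent \<open>0\<close> or \<open>1\<close> at
    \<open>l\<close>; the same \<open>x\<close> then witnesses one of the two alternatives.\<close>
  have cotrans: "D b b' i l \<or> D b b' l k" if "D b b' i k" "l \<in> keys m" for b b' i k l
  proof -
    from that(1) obtain x where x: "lookup (E b) x = 1" "lookup (E b') x = 0"
        "lookup (E i) x = 1" "lookup (E k) x = 0" unfolding D_def by blast
    have "lookup (E l) x = 0 \<or> lookup (E l) x = 1" using sfm[OF that(2), of x] by linarith
    with x show ?thesis unfolding D_def by blast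
  qed
  \<comment> \<open>Reading the support in both orders makes \<open>sources\<close> and
    \<open>targets\<close> supply the conditions for \<open>D b1 b2\<close> as well as for
    \<open>D b2 b1\<close>.\<close>
  have bb': "keys m' = {b2, b1}" using bb by blast
  have "\<exists>i\<in>{u, v, w}. \<exists>k\<in>{u, v, w}. D b1 b2 i k \<and> D b1 b2 k i \<and> D b2 b1 i k \<and> D b2 b1 k i"
  proof (rule cotransitive_pair)
    show "\<not> D b1 b2 i i" "\<not> D b2 b1 i i" for i by (rule irrefl)+
    show "\<forall>i k. \<forall>l\<in>{u, v, w}. D b1 b2 i k \<longrightarrow> D b1 b2 i l \<or> D b1 b2 l k"
      "\<forall>i k. \<forall>l\<in>{u, v, w}. D b2 b1 i k \<longrightarrow> D b2 b1 i l \<or> D b2 b1 l k"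
      using cotrans unfolding uvw by blast+
    show "\<forall>i\<in>{u, v, w}. \<exists>k\<in>{u, v, w}. D b1 b2 i k" using targets[OF _ bb'] unfolding uvw by blast
    show "\<forall>i\<in>{u, v, w}. \<exists>k\<in>{u, v, w}. D b1 b2 k i" using sources[OF _ bb] unfolding uvw by blast
    show "\<forall>i\<in>{u, v, w}. \<exists>k\<in>{u, v, w}. D b2 b1 i k" using targets[OF _ bb] unfolding uvw by blast
    show "\<forall>i\<in>{u, v, w}. \<exists>k\<in>{u, v, w}. D b2 b1 k i" using sources[OF _ bb'] unfolding uvw by blast
  qed
  then show ?thesis unfolding uvw bb by blast
qed

text \<open>The candidates are \<open>m\<close> or \<open>m'\<close> with one factor traded for a
  factor of the other. The bound by the maximum keeps such a \<open>p\<close> in the fibre: a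
  monomial divisible by both weights is divisible by that of \<open>p\<close>. If every trade fails,
  \<open>blocked_exchange_pattern\<close>, applied with a support of at most two elements in second
  place, contradicts \<open>no_pattern\<close>.\<close>

lemma exchange:
  fixes E :: "nat \<Rightarrow> ('x \<Rightarrow>\<^sub>0 nat)"
  assumes sf: "\<And>i x. i \<in> {1..n} \<Longrightarrow> lookup (E i) x \<le> 1" and "n \<le> 5"
    and keys: "keys m \<subseteq> {1..n}" "keys m' \<subseteq> {1..n}" "keys m \<inter> keys m' = {}"
    and deg: "T_degree m = T_degree m'" "2 \<le> T_degree m"
    and D_def: "D = (\<lambda>b b' i k. \<exists>x. lookup (E b) x = 1 \<and> lookup (E b') x = 0 \<and>
        lookup (E i) x = 1 \<and> lookup (E k) x = 0)"
    and no_pattern: "\<And>i k b b'. {i, k, b, b'} \<subseteq> {1..n} \<Longrightarrow> {i, k} \<inter> {b, b'} = {} \<Longrightarrow>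
      D b b' i k \<Longrightarrow> D b b' k i \<Longrightarrow> D b' b i k \<Longrightarrow> D b' b k i \<Longrightarrow> False"
  obtains p where "keys p \<subseteq> {1..n}" "T_degree p = T_degree m" "keys p \<inter> keys m \<noteq> {}"
    "keys p \<inter> keys m' \<noteq> {}"
    "\<And>x. lookup (T_weight E p) x \<le> max (lookup (T_weight E m) x) (lookup (T_weight E m') x)"
proof -
  define Q where "Q p \<longleftrightarrow> keys p \<subseteq> {1..n} \<and> T_degree p = T_degree m \<and> keys p \<inter> keys m \<noteq> {} \<and>
    keys p \<inter> keys m' \<noteq> {} \<and>
    (\<forall>x. lookup (T_weight E p) x \<le> max (lookup (T_weight E m) x) (lookup (T_weight E m') x))" for p
  \<comment> \<open>The unordered pair \<open>{q, q'}\<close> lets one argument cover trades in both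
    directions.\<close>
  have move: "\<exists>x. lookup (E a) x < lookup (E b) x \<and>
      lookup (T_weight E q') x \<le> lookup (T_weight E q) x"
    if "\<not> (\<exists>p. Q p)" and ab: "a \<in> keys q" "b \<in> keys q'" and q: "{q, q'} = {m, m'}" for a b q q'
  proof (rule ccontr)
    assume *: "\<not> ?thesis"
    let ?r = "q - Poly_Mapping.single a 1"
    let ?p = "?r + Poly_Mapping.single b 1"
    have q_deg: "T_degree q = T_degree m" "keys q \<subseteq> {1..n}" "keys q' \<subseteq> {1..n}"
      using q deg keys by (auto simp: doubleton_eq_iff)
    have "Suc (T_degree ?r) = T_degree q" using T_degree_minus_single[OF ab(1)] .
    then have deg_p: "T_degree ?p = T_degree m" "?r \<noteq> 0"
      using q_deg deg T_degree_eq_0_iff[of ?r] by (auto simp: T_degree_add)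
    have b: "b \<in> keys ?p" by (simp add: keys_add_nat)
    have sub: "keys ?r \<subseteq> keys q" by (rule keys_minus_single_subset)
    \<comment> \<open>Since the degree is at least two, a factor of \<open>q\<close> survives the
      removal, so the new monomial still meets \<open>q\<close>.\<close>
    obtain c where "c \<in> keys ?r" using deg_p(2)
      by (auto simp: poly_mapping_eq_iff fun_eq_iff in_keys_iff)
    then have c: "c \<in> keys ?p" "c \<in> keys q" using sub by (auto simp: keys_add_nat)
    have le: "lookup (T_weight E ?p) x \<le> max (lookup (T_weight E q) x) (lookup (T_weight E q') x)"
      for x
    proof -
      have "lookup (T_weight E ?r) x + lookup (E a) x = lookup (T_weight E q) x"
        using T_weight_minus_single[OF ab(1), of E] by (metis lookup_add)
      moreover have "lookup (T_weight E ?p) x = lookup (T_weight E ?r) x + lookup (E b) x"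
        by (simp add: T_weight_add lookup_add)
      moreover have "lookup (E b) x \<le> 1" using sf ab(2) q_deg by blast
      \<comment> \<open>Either the trade does not raise the exponent of \<open>x\<close>, or the
        weight in \<open>q'\<close> exceeds that in \<open>q\<close> and leaves room for the one
        extra power.\<close>
      moreover have "lookup (E b) x \<le> lookup (E a) x \<or>
          lookup (T_weight E q) x < lookup (T_weight E q') x"
        using * by (meson not_le)
      ultimately show ?thesis by linarith
    qed
    have "keys ?p \<subseteq> {1..n}" using sub q_deg ab(2) by (auto simp: keys_add_nat)
    moreover have "keys ?p \<inter> keys q \<noteq> {}" "keys ?p \<inter> keys q' \<noteq> {}" using b c ab(2) by blast+
    ultimately have "Q ?p" unfolding Q_def using le deg_p q
      by (auto simp: doubleton_eq_iff max.commute)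
    then show False using that(1) by blast
  qed
  have "\<exists>p. Q p"
  proof (rule ccontr)
    assume nQ: "\<not> (\<exists>p. Q p)"
    have blocked: "\<exists>x. lookup (E a) x < lookup (E b) x \<and>
        lookup (T_weight E m') x \<le> lookup (T_weight E m) x"
      "\<exists>x. lookup (E b) x < lookup (E a) x \<and>
        lookup (T_weight E m) x \<le> lookup (T_weight E m') x"
      if "a \<in> keys m" "b \<in> keys m'" for a b
      using move[OF nQ that] move[OF nQ that(2,1)] by auto
    have "card (keys m) + card (keys m') = card (keys m \<union> keys m')"
      using keys(3) by (simp add: card_Un_disjoint)
    also have "\<dots> \<le> card {1..n}" using keys by (intro card_mono) auto
    finally have card: "card (keys m) + card (keys m') \<le> 5" using \<open>n \<le> 5\<close> by simp
    have nz: "m \<noteq> 0" "m' \<noteq> 0"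
      using deg T_degree_eq_0_iff[of m] T_degree_eq_0_iff[of m'] by auto
    have sf': "lookup (E i) x \<le> 1" if "i \<in> keys m \<union> keys m'" for i x using sf that keys by blast
    from card consider "card (keys m') \<le> 2" | "card (keys m) \<le> 2" by linarith
    then show False
    proof cases
      case 1
      from blocked_exchange_pattern[OF sf' deg(1) nz(1) 1 card blocked D_def]
      obtain i k b b' where ikb: "i \<in> keys m" "k \<in> keys m" "b \<in> keys m'" "b' \<in> keys m'"
        and D: "D b b' i k" "D b b' k i" "D b' b i k" "D b' b k i" by blast
      show False by (rule no_pattern[OF _ _ D]) (use ikb keys in blast)+
    next
      case 2
      have "card (keys m') + card (keys m) \<le> 5" using card by simp
      \<comment> \<open>The roles of \<open>m\<close> and \<open>m'\<close> are swapped, which also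
        swaps the two families of blocking variables.\<close>
      from blocked_exchange_pattern[OF _ deg(1)[symmetric] nz(2) 2 this blocked(2,1) D_def] sf'
      obtain i k b b' where ikb: "i \<in> keys m'" "k \<in> keys m'" "b \<in> keys m" "b' \<in> keys m"
        and D: "D b b' i k" "D b b' k i" "D b' b i k" "D b' b k i" by blast
      show False by (rule no_pattern[OF _ _ D]) (use ikb keys in blast)+
    qed
  qed
  then obtain p where "Q p" by blast
  then show ?thesis unfolding Q_def by (intro that[of p]) auto
qed

section \<open>Linear type\<close>

lemma rees_map_monomial:
  fixes f :: "nat \<Rightarrow> ('x, 'k::field) mpoly_ring"
  assumes "\<forall>i\<in>{1..n}. f i = Poly_Mapping.single (E i) 1" "keys m \<subseteq> {1..n}"
  shows "rees_map f (Poly_Mapping.single m (Poly_Mapping.single e c)) =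
    Polynomial.monom (Poly_Mapping.single (e + T_weight E m) c) (T_degree m)"
proof -
  have "T_image f m = Polynomial.monom (Poly_Mapping.single (T_weight E m) 1) (T_degree m)"
    using assms by (intro T_image_monomials) blast
  then show ?thesis by (simp add: rees_map_single smult_monom mult_single)
qed

text \<open>\<open>K\<close> is an arbitrary ideal containing the linear part of J, matching the
  description of the generated ideal as an intersection. The induction keeps \<open>e\<close> and
  \<open>e'\<close> arbitrary because passing through a third monomial changes the coefficient
  exponent.\<close>

lemma monomials_congruent:
  fixes f :: "nat \<Rightarrow> ('x, 'k::field) mpoly_ring"
  assumes K: "ideal K (T_ring n)" and lin: "{P \<in> rees_ideal I n f. T_homogeneous 1 P} \<subseteq> K"
    and f: "\<forall>i\<in>{1..n}. f i = Poly_Mapping.single (E i) 1"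
    and exch: "\<And>m m'. keys m \<subseteq> {1..n} \<Longrightarrow> keys m' \<subseteq> {1..n} \<Longrightarrow> keys m \<inter> keys m' = {} \<Longrightarrow>
      T_degree m = T_degree m' \<Longrightarrow> 2 \<le> T_degree m \<Longrightarrow>
      \<exists>p. keys p \<subseteq> {1..n} \<and> T_degree p = T_degree m \<and> keys p \<inter> keys m \<noteq> {} \<and>
        keys p \<inter> keys m' \<noteq> {} \<and>
        (\<forall>x. lookup (T_weight E p) x \<le> max (lookup (T_weight E m) x) (lookup (T_weight E m') x))"
    and "keys m \<subseteq> {1..n}" "keys m' \<subseteq> {1..n}" "T_degree m = d" "T_degree m' = d"
    and "e + T_weight E m = e' + T_weight E m'"
  shows "Poly_Mapping.single m (Poly_Mapping.single e 1)
    - Poly_Mapping.single m' (Poly_Mapping.single e' 1) \<in> K"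
  using assms(5-)
proof (induction d arbitrary: m m' e e')
  case 0
  then have "m = 0" "m' = 0" by (simp_all add: T_degree_eq_0_iff)
  moreover from this have "e = e'" using "0.prems"(5) by simp
  ultimately show ?case using ideal_T_ring_closed(1)[OF K] by simp
next
  case (Suc d)
  let ?M = "\<lambda>m e. Poly_Mapping.single m (Poly_Mapping.single e 1) :: (nat, ('x, 'k) mpoly_ring) mpoly_ring"
  \<comment> \<open>Cancelling a common T_i leaves two monomials of degree \<open>d\<close> in one
    fibre; the induction hypothesis is then multiplied back by T_i.\<close>
  have share: "?M p a - ?M q b \<in> K"
    if pq: "keys p \<subseteq> {1..n}" "keys q \<subseteq> {1..n}" "T_degree p = Suc d" "T_degree q = Suc d"
      "a + T_weight E p = b + T_weight E q" and common: "keys p \<inter> keys q \<noteq> {}" for p q a b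
  proof -
    obtain i where i: "i \<in> keys p" "i \<in> keys q" using common by blast
    let ?t = "Poly_Mapping.single i (1::nat)"
    let ?p = "p - ?t" and ?q = "q - ?t"
    have "?M ?p a - ?M ?q b \<in> K"
    proof (rule Suc.IH)
      show "keys ?p \<subseteq> {1..n}" "keys ?q \<subseteq> {1..n}"
        using keys_minus_single_subset[of p i] keys_minus_single_subset[of q i] pq(1,2) by auto
      show "T_degree ?p = d" "T_degree ?q = d"
        using T_degree_minus_single[OF i(1)] T_degree_minus_single[OF i(2)] pq(3,4) by auto
      have "(a + T_weight E ?p) + E i = (b + T_weight E ?q) + E i"
        using pq(5) unfolding T_weight_minus_single[OF i(1), of E, symmetric]
          T_weight_minus_single[OF i(2), of E, symmetric] by (simp only: add.assoc)
      then show "a + T_weight E ?p = b + T_weight E ?q" by (rule add_right_imp_eq)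
    qed
    moreover have "Poly_Mapping.single ?t 1 \<in> carrier (T_ring n)"
      using i(1) pq(1) by (intro single_mem_T_ring) auto
    ultimately have "Poly_Mapping.single ?t 1 * (?M ?p a - ?M ?q b) \<in> K"
      by (rule ideal_T_ring_closed(3)[OF K])
    also have "Poly_Mapping.single ?t 1 * (?M ?p a - ?M ?q b) = ?M (?p + ?t) a - ?M (?q + ?t) b"
      by (simp add: right_diff_distrib mult_single add.commute)
    finally show ?thesis unfolding minus_single_add[OF i(1)] minus_single_add[OF i(2)] .
  qed
  show ?case
  proof (cases "d = 0 \<or> keys m \<inter> keys m' \<noteq> {}")
    case True
    then show ?thesis
    proof
      \<comment> \<open>In degree one the difference is itself a linear element of the
        kernel.\<close>
      assume "d = 0"
      let ?P = "?M m e - ?M m' e'"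
      have keys: "keys ?P \<subseteq> {m, m'}" by (auto simp: in_keys_iff lookup_minus lookup_single when_def split: if_splits)
      have "T_homogeneous 1 ?P"
        unfolding T_homogeneous_def T_degree_def[symmetric]
        using keys Suc.prems(3,4) \<open>d = 0\<close> by auto
      moreover have "?P \<in> carrier (T_ring n)"
        unfolding mem_T_ring using keys Suc.prems(1,2) by blast
      moreover have "rees_map f ?P = 0"
        using rees_map_add[of f "?M m e" "- ?M m' e'"] Suc.prems
        by (simp add: rees_map_uminus rees_map_monomial[OF f])
      ultimately show ?thesis using lin by (auto simp: mem_rees_ideal)
    next
      assume "keys m \<inter> keys m' \<noteq> {}"
      then show ?thesis using Suc.prems by (intro share)
    qed
  next
    case False
    then obtain p where p: "keys p \<subseteq> {1..n}" "T_degree p = Suc d" "keys p \<inter> keys m \<noteq> {}"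
        "keys p \<inter> keys m' \<noteq> {}"
        and le: "\<And>x. lookup (T_weight E p) x
          \<le> max (lookup (T_weight E m) x) (lookup (T_weight E m') x)"
      using exch[of m m'] Suc.prems by auto
    let ?w = "e + T_weight E m"
    \<comment> \<open>The common exponent \<open>?w\<close> of the fibre dominates both weights,
      hence that of \<open>p\<close>. So the truncated difference \<open>?w - T_weight E p\<close>
      is exact and completes T^p to a member of the fibre.\<close>
    have "lookup (T_weight E p) x \<le> lookup ?w x" for x
    proof -
      have "lookup ?w x = lookup (e' + T_weight E m') x" using Suc.prems(5) by simp
      then show ?thesis using le[of x] by (simp add: lookup_add)
    qed
    then have w: "(?w - T_weight E p) + T_weight E p = ?w" by (rule minus_add_pointwise_le)
    have "?M m e - ?M p (?w - T_weight E p) \<in> K"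
      by (rule share) (use Suc.prems p w in auto)
    moreover have "?M p (?w - T_weight E p) - ?M m' e' \<in> K"
      by (rule share) (use Suc.prems p w in auto)
    ultimately have "(?M m e - ?M p (?w - T_weight E p)) + (?M p (?w - T_weight E p) - ?M m' e') \<in> K"
      by (rule ideal_T_ring_closed(2)[OF K])
    then show ?thesis by simp
  qed
qed

text \<open>Terms are grouped by the monomial of R[t] to which \<phi> sends them. Distinct groups
  cannot cancel, so the coefficients of \<open>P\<close> sum to zero within each group, which makes
  that part of \<open>P\<close> a combination of differences of congruent monomials.\<close>

lemma kernel_subset_of_congruent:
  fixes f :: "nat \<Rightarrow> ('x, 'k::field) mpoly_ring"
  assumes K: "ideal K (T_ring n)"
    and f: "\<forall>i\<in>{1..n}. f i = Poly_Mapping.single (E i) 1"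
    and congr: "\<And>m m' e e'. keys m \<subseteq> {1..n} \<Longrightarrow> keys m' \<subseteq> {1..n} \<Longrightarrow> T_degree m = T_degree m' \<Longrightarrow>
      e + T_weight E m = e' + T_weight E m' \<Longrightarrow>
      Poly_Mapping.single m (Poly_Mapping.single e 1)
        - Poly_Mapping.single m' (Poly_Mapping.single e' 1) \<in> K"
    and P: "P \<in> rees_ideal I n f"
  shows "P \<in> K"
proof -
  let ?M = "\<lambda>m e c. Poly_Mapping.single m (Poly_Mapping.single e c) :: (nat, ('x, 'k) mpoly_ring) mpoly_ring"
  \<comment> \<open>\<open>A\<close> indexes the terms x^e T^m of \<open>P\<close>, \<open>c\<close>
    gives their coefficients in the field, and \<open>g\<close> the exponents of t and of the
    variables of R in their images.\<close>
  define A where "A = (SIGMA m : keys P. keys (lookup P m))"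
  define c where "c = (\<lambda>(m, e). lookup (lookup P m) e)"
  define g where "g = (\<lambda>(m, e). (T_degree m, e + T_weight E m))"
  define mon where "mon = (\<lambda>(m, e). ?M m e)"
  have fin: "finite A" unfolding A_def by simp
  have keysA: "keys (fst t) \<subseteq> {1..n}" if "t \<in> A" for t
    using that P unfolding A_def mem_rees_ideal mem_T_ring by auto
  have single_sum: "Poly_Mapping.single m (sum h B) = (\<Sum>e\<in>B. Poly_Mapping.single m (h e))"
    for m :: "nat \<Rightarrow>\<^sub>0 nat" and B :: "('x \<Rightarrow>\<^sub>0 nat) set" and h :: "_ \<Rightarrow> ('x, 'k) mpoly_ring"
    by (induction B rule: infinite_finite_induct) (auto simp: single_add)
  have "P = (\<Sum>m\<in>keys P. Poly_Mapping.single m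
      (\<Sum>e\<in>keys (lookup P m). Poly_Mapping.single e (lookup (lookup P m) e)))"
    by (simp only: sum_single_lookup)
  also have "\<dots> = (\<Sum>t\<in>A. mon t (c t))"
    unfolding single_sum A_def mon_def c_def by (subst sum.Sigma) (auto simp: case_prod_unfold)
  finally have PA: "P = (\<Sum>t\<in>A. mon t (c t))" .
  have fibre_sum: "(\<Sum>t\<in>{t\<in>A. g t = y}. c t) = 0" for y
  proof -
    obtain d w where y: "y = (d, w)" by (cases y)
    have "rees_map f (mon t (c t)) = Polynomial.monom (Poly_Mapping.single (snd (g t)) (c t)) (fst (g t))"
      if "t \<in> A" for t
      by (simp add: mon_def g_def case_prod_unfold rees_map_monomial[OF f keysA[OF that]])
    then have "rees_map f P =
        (\<Sum>t\<in>A. Polynomial.monom (Poly_Mapping.single (snd (g t)) (c t)) (fst (g t)))"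
      unfolding PA rees_map_sum by (rule sum.cong[OF refl])
    moreover have "rees_map f P = 0" using P unfolding mem_rees_ideal by blast
    \<comment> \<open>Reading off the coefficient of x^w t^d isolates the terms of the fibre over
      \<open>y\<close>.\<close>
    ultimately have "0 = lookup (Polynomial.coeff
        (\<Sum>t\<in>A. Polynomial.monom (Poly_Mapping.single (snd (g t)) (c t)) (fst (g t))) d) w"
      by simp
    also have "\<dots> = (\<Sum>t\<in>A. if g t = y then c t else 0)"
      unfolding coeff_sum lookup_sum
      by (rule sum.cong) (auto simp: y lookup_single when_def prod_eq_iff)
    also have "\<dots> = (\<Sum>t\<in>{t\<in>A. g t = y}. c t)"
      using fin by (simp add: sum.inter_filter)
    finally show ?thesis by simp
  qed
  have fibre: "(\<Sum>t\<in>{t\<in>A. g t = y}. mon t (c t)) \<in> K" if y: "y \<in> g ` A" for y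
  proof -
    obtain u where u: "u \<in> A" "g u = y" using y by blast
    have mon_add: "mon u (a + b) = mon u a + mon u b" for a b
      by (simp add: mon_def case_prod_unfold single_add)
    have mon_sum: "(\<Sum>t\<in>B. mon u (c t)) = mon u (sum c B)" for B
      by (induction B rule: infinite_finite_induct)
        (auto simp: mon_add, simp_all add: mon_def case_prod_unfold)
    \<comment> \<open>All terms are compared with one representative \<open>u\<close>; what is
      subtracted adds up to the coefficient sum of the fibre, which is zero.\<close>
    have "(\<Sum>t\<in>{t\<in>A. g t = y}. mon t (c t))
        = (\<Sum>t\<in>{t\<in>A. g t = y}. mon t (c t) - mon u (c t)) + mon u (\<Sum>t\<in>{t\<in>A. g t = y}. c t)"
      by (simp add: sum_subtractf mon_sum)
    also have "\<dots> = (\<Sum>t\<in>{t\<in>A. g t = y}. mon t (c t) - mon u (c t))"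
      unfolding fibre_sum by (simp add: mon_def case_prod_unfold)
    also have "\<dots> \<in> K"
    proof (rule ideal_T_ring_closed(4)[OF K])
      fix t assume t: "t \<in> {t\<in>A. g t = y}"
      have "mon t 1 - mon u 1 \<in> K"
        using congr[of "fst t" "fst u" "snd t" "snd u"] keysA[of t] keysA[of u] t u
        by (auto simp: mon_def g_def case_prod_unfold)
      \<comment> \<open>The field element \<open>c t\<close>, viewed as a constant of S, scales the
        congruence between monic terms.\<close>
      moreover have "?M 0 0 (c t) \<in> carrier (T_ring n)" by (simp add: single_mem_T_ring)
      ultimately have "?M 0 0 (c t) * (mon t 1 - mon u 1) \<in> K"
        by (rule ideal_T_ring_closed(3)[OF K])
      then show "mon t (c t) - mon u (c t) \<in> K"
        by (simp add: mon_def case_prod_unfold right_diff_distrib mult_single)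
    qed
    finally show ?thesis .
  qed
  have "P = (\<Sum>y\<in>g ` A. \<Sum>t\<in>{t\<in>A. g t = y}. mon t (c t))"
    using PA sum.image_gen[OF fin, of "\<lambda>t. mon t (c t)" g] by simp
  also have "\<dots> \<in> K" using fibre by (rule ideal_T_ring_closed(4)[OF K])
  finally show ?thesis .
qed

theorem theorem2p15:
  fixes I :: "('x, 'k::field) mpoly_ring set"
    and n :: nat
    and f :: "nat \<Rightarrow> ('x, 'k) mpoly_ring"
  assumes "is_squarefree_monomial_ideal I"
    and "is_minimal_monomial_generating_set I n f"
    and "n \<le> 5"
    and "\<not> (\<exists>(s::nat) (\<alpha>::nat list) (\<beta>::nat list) b1 b2.
           s \<ge> 2 \<and> length \<alpha> = s \<and> length \<beta> = s \<and>
           mset \<beta> = mset (replicate (s - 1) b1 @ [b2]) \<and>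
           set \<alpha> \<subseteq> {1..n} \<and> set \<beta> \<subseteq> {1..n} \<and>
           (\<forall>i<s. \<forall>j<s. \<alpha> ! i \<noteq> \<beta> ! j) \<and>
           (\<forall>i<s. \<exists>x. (\<forall>j<s. j \<noteq> i \<longrightarrow> Var x dvd f (\<alpha> ! j)) \<and> Var x dvd f b1 \<and>
                      \<not> Var x dvd f (\<alpha> ! i) \<and> \<not> Var x dvd f b2) \<and>
           (\<forall>i<s. \<exists>z. Var z dvd f (\<alpha> ! i) \<and> Var z dvd f b2 \<and>
                      (\<forall>j<s. j \<noteq> i \<longrightarrow> \<not> Var z dvd f (\<alpha> ! j)) \<and> \<not> Var z dvd f b1))"
  shows "is_of_linear_type I n f"
proof -
  obtain E where f: "\<forall>i\<in>{1..n}. f i = Poly_Mapping.single (E i) 1"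
    and sf: "\<And>i x. i \<in> {1..n} \<Longrightarrow> lookup (E i) x \<le> 1"
    using minimal_generators_squarefree[OF assms(1,2)] by metis
  define D where "D = (\<lambda>b b' i k. \<exists>x. lookup (E b) x = 1 \<and> lookup (E b') x = 0 \<and>
        lookup (E i) x = 1 \<and> lookup (E k) x = 0)"
  have Var_dvd: "Var x dvd f i \<longleftrightarrow> lookup (E i) x \<noteq> 0" if "i \<in> {1..n}" for i x
    unfolding bspec[OF f that] by (rule Var_dvd_single_iff)
  have no_pattern: False
    if sub: "{i, k, b, b'} \<subseteq> {1..n}" and disj: "{i, k} \<inter> {b, b'} = {}"
      and D: "D b b' i k" "D b b' k i" "D b' b i k" "D b' b k i" for i k b b'
  proof -
    have dvd: "\<exists>x. Var x dvd f p \<and> \<not> Var x dvd f q \<and> Var x dvd f u \<and> \<not> Var x dvd f v"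
      if "D p q u v" "{p, q, u, v} \<subseteq> {1..n}" for p q u v
      using that Var_dvd unfolding D_def by fastforce
    have all2: "(\<forall>j<2. Q j) \<longleftrightarrow> Q 0 \<and> Q (1::nat)" for Q by (auto simp: less_2_cases_iff)
    \<comment> \<open>The forbidden pattern has \<open>s = 2\<close>, \<alpha> =
      \<open>[i, k]\<close> and \<beta> = \<open>[b, b']\<close>, with \<open>b\<close> as b_1 and
      \<open>b'\<close> as b_2.\<close>
    show False
    proof (rule notE[OF assms(4)], intro exI conjI)
      show "(2::nat) \<le> 2" by simp
      show "length [i, k] = 2" "length [b, b'] = 2" by simp_all
      show "mset [b, b'] = mset (replicate (2 - 1) b @ [b'])" by simp
      show "set [i, k] \<subseteq> {1..n}" "set [b, b'] \<subseteq> {1..n}" using sub by auto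
      show "\<forall>j<2. \<forall>j'<2. [i, k] ! j \<noteq> [b, b'] ! j'" using disj unfolding all2 by auto
      \<comment> \<open>At \<open>i\<close> and \<open>k\<close> the first condition is
        \<open>D b b' k i\<close> and \<open>D b b' i k\<close>; the second is
        \<open>D b' b i k\<close> and \<open>D b' b k i\<close>.\<close>
      show "\<forall>j<2. \<exists>x. (\<forall>j'<2. j' \<noteq> j \<longrightarrow> Var x dvd f ([i, k] ! j')) \<and> Var x dvd f b \<and>
          \<not> Var x dvd f ([i, k] ! j) \<and> \<not> Var x dvd f b'"
        unfolding all2 using dvd[OF D(1)] dvd[OF D(2)] sub by auto
      show "\<forall>j<2. \<exists>z. Var z dvd f ([i, k] ! j) \<and> Var z dvd f b' \<and>
          (\<forall>j'<2. j' \<noteq> j \<longrightarrow> \<not> Var z dvd f ([i, k] ! j')) \<and> \<not> Var z dvd f b"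
        unfolding all2 using dvd[OF D(3)] dvd[OF D(4)] sub by auto
    qed
  qed
  let ?L = "{P \<in> rees_ideal I n f. T_homogeneous 1 P}"
  \<comment> \<open>The generated ideal is the intersection of all such \<open>K\<close>, so
    membership is shown in each of them.\<close>
  have "P \<in> K" if K: "ideal K (T_ring n)" "?L \<subseteq> K" and P: "P \<in> rees_ideal I n f" for P K
  proof (rule kernel_subset_of_congruent[OF K(1) f _ P])
    fix m m' e e'
    assume m: "keys m \<subseteq> {1..n}" "keys m' \<subseteq> {1..n}" "T_degree m = T_degree m'"
      "e + T_weight E m = e' + T_weight E m'"
    show "Poly_Mapping.single m (Poly_Mapping.single e 1)
        - Poly_Mapping.single m' (Poly_Mapping.single e' 1) \<in> K"
    proof (rule monomials_congruent[OF K f _ m(1,2) m(3) refl m(4)])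
      fix p p'
      assume p: "keys p \<subseteq> {1..n}" "keys p' \<subseteq> {1..n}" "keys p \<inter> keys p' = {}"
        "T_degree p = T_degree p'" "2 \<le> T_degree p"
      show "\<exists>q. keys q \<subseteq> {1..n} \<and> T_degree q = T_degree p \<and> keys q \<inter> keys p \<noteq> {} \<and>
        keys q \<inter> keys p' \<noteq> {} \<and>
        (\<forall>x. lookup (T_weight E q) x \<le> max (lookup (T_weight E p) x) (lookup (T_weight E p') x))"
        by (rule exchange[OF sf \<open>n \<le> 5\<close> p D_def no_pattern]) blast+
    qed
  qed
  then have "rees_ideal I n f \<subseteq> Idl\<^bsub>T_ring n\<^esub> ?L" unfolding genideal_def by blast
  moreover have "Idl\<^bsub>T_ring n\<^esub> ?L \<subseteq> rees_ideal I n f"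
    by (rule ring.genideal_minimal[OF T_ring_ring rees_ideal_is_ideal]) blast
  ultimately show ?thesis unfolding is_of_linear_type_def by blast
qed

end
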